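(* Let $K$ be a field and let $S$ be a $K$-algebra with a pseudo-degree function $\chi$. Let $a \in S$ be such that the centralizer $C_S(a)$ satisfies condition $D(\ell)$ (with respect to $\chi$) for some integer $\ell > 0$. Let $b$ be any element of $C_S(a)$. Then there exists a nonzero polynomial $P(s,t) \in K[s,t]$ such that $P(a,b) = 0$.
   Context: All rings and algebras are associative and unital. For a ring $S$ and $a \in S$, the centralizer $C_S(a)$ is the set of all elements of $S$ that commute with $a$. $K[s,t]$ is the polynomial ring in two commuting indeterminates; $P(a,b)$ is well-defined because $a$ and $b$ commute. Pseudo-degree function: for a $K$-algebra $S$, a function $\chi : S \to \mathbb{Z} \cup \{-\infty\}$ is called a pseudo-degree function if (i) $\chi(a) = -\infty$ if and only if $a = 0$; (ii) $\chi(ab) = \chi(a) + \chi(b)$ for all $a,b \in S$; (iii) $\chi(a+b) \leq \max(\chi(a),\chi(b))$ for all $a,b \in S$. Condition $D(\ell)$: let $S$ be a $K$-algebra with pseudo-degree function $\chi$ and let $\ell$ be a positive integer. A subalgebra $B \subset S$ satisfies condition $D(\ell)$ if $\chi(b) \geq 0$ for all non-zero $b \in B$ and if, whenever $b_1, \ldots, b_{\ell+1} \in B$ are $\ell+1$ elements all mapped to the same integer by $\chi$ (in particular they are all non-zero), there exist $\alpha_1, \ldots, \alpha_{\ell+1} \in K$, not all zero, such that $\chi\left(\sum_{i=1}^{\ell+1} \alpha_i b_i\right) < \chi(b_1)$. *)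

theory Defs
  imports "HOL-Library.Extended" "HOL-Computational_Algebra.Polynomial"
begin

text \<open>
  The sort \<open>{ring, monoid_mult}\<close> is that of associative unital rings, not necessarily commutative;
  unlike \<open>ring_1\<close> it does not exclude the zero ring.
\<close>

locale K_algebra = vector_space scale
  for scale :: "'k::field \<Rightarrow> 's::{ring,monoid_mult} \<Rightarrow> 's" (infixr \<open>*\<^sub>K\<close> 75) +
  assumes scale_mult_left: "c *\<^sub>K (x * y) = (c *\<^sub>K x) * y"
    and scale_mult_right: "c *\<^sub>K (x * y) = x * (c *\<^sub>K y)"

definition centralizer :: "'s::{ring,monoid_mult} \<Rightarrow> 's set" where
  "centralizer a = {x. x * a = a * x}"

text \<open>
  The codomain of a pseudo-degree function is the set of integers together with minus infinity.
  The type \<open>int extended\<close> has in addition the value \<open>Pinf\<close>, which is excluded explicitly;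
  on the remaining values its order and addition are the usual ones.
\<close>

definition pseudo_degree :: "('s::{ring,monoid_mult} \<Rightarrow> int extended) \<Rightarrow> bool" where
  "pseudo_degree \<chi> \<longleftrightarrow>
     (\<forall>a. \<chi> a \<noteq> Pinf) \<and>
     (\<forall>a. \<chi> a = Minf \<longleftrightarrow> a = 0) \<and>
     (\<forall>a b. \<chi> (a * b) = \<chi> a + \<chi> b) \<and>
     (\<forall>a b. \<chi> (a + b) \<le> max (\<chi> a) (\<chi> b))"

definition is_subalgebra :: "('k::field \<Rightarrow> 's::{ring,monoid_mult} \<Rightarrow> 's) \<Rightarrow> 's set \<Rightarrow> bool" where
  "is_subalgebra scale B \<longleftrightarrow>
     module.subspace scale B \<and> 1 \<in> B \<and> (\<forall>x\<in>B. \<forall>y\<in>B. x * y \<in> B)"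

text \<open>
  Condition \<open>D(l)\<close>. It is meant for subalgebras \<open>B\<close>; centralizers are subalgebras by
  \<open>is_subalgebra_centralizer\<close> below. The elements \<open>b 1, \<dots>, b (l + 1)\<close> form a family,
  so repetitions are allowed (and harmless).
\<close>

definition condition_D ::
  "('k::field \<Rightarrow> 's::{ring,monoid_mult} \<Rightarrow> 's) \<Rightarrow> ('s \<Rightarrow> int extended) \<Rightarrow> nat \<Rightarrow> 's set \<Rightarrow> bool" where
  "condition_D scale \<chi> l B \<longleftrightarrow>
     (\<forall>x\<in>B. x \<noteq> 0 \<longrightarrow> 0 \<le> \<chi> x) \<and>
     (\<forall>(b :: nat \<Rightarrow> 's) (n :: int).
        (\<forall>i\<in>{1..l+1}. b i \<in> B \<and> \<chi> (b i) = Fin n) \<longrightarrow>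
        (\<exists>\<alpha> :: nat \<Rightarrow> 'k. (\<exists>i\<in>{1..l+1}. \<alpha> i \<noteq> 0) \<and>
           \<chi> (\<Sum>i=1..l+1. scale (\<alpha> i) (b i)) < \<chi> (b 1)))"

text \<open>
  \<open>K[s,t]\<close> is represented as \<open>K[s][t]\<close>, the type \<open>'k poly poly\<close>: the coefficient of
  \<open>s^i t^j\<close> in \<open>P\<close> is \<open>coeff (coeff P j) i\<close>. The value below is \<open>P(a,b)\<close> for commuting
  \<open>a\<close> and \<open>b\<close>.
\<close>

definition eval2 :: "('k::field \<Rightarrow> 's::{ring,monoid_mult} \<Rightarrow> 's) \<Rightarrow> 'k poly poly \<Rightarrow> 's \<Rightarrow> 's \<Rightarrow> 's" where
  "eval2 scale P a b =
     (\<Sum>j\<le>degree P. \<Sum>i\<le>degree (coeff P j). scale (coeff (coeff P j) i) (a ^ i * b ^ j))"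

lemma (in K_algebra) is_subalgebra_centralizer: "is_subalgebra scale (centralizer a)"
  unfolding is_subalgebra_def
proof (intro conjI ballI)
  show "subspace (centralizer a)"
  proof (rule subspaceI)
    show "0 \<in> centralizer a"
      by (simp add: centralizer_def)
    show "x + y \<in> centralizer a" if "x \<in> centralizer a" "y \<in> centralizer a" for x y
      using that by (simp add: centralizer_def distrib_left distrib_right)
    show "c *\<^sub>K x \<in> centralizer a" if "x \<in> centralizer a" for c x
      using that scale_mult_left[of c x a] scale_mult_right[of c a x]
      by (simp add: centralizer_def)
  qed
  show "1 \<in> centralizer a"
    by (simp add: centralizer_def)
  show "x * y \<in> centralizer a" if "x \<in> centralizer a" "y \<in> centralizer a" for x y
  proof -
    have x: "x * a = a * x" and y: "y * a = a * y"
      using that by (simp_all add: centralizer_def)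
    have "(x * y) * a = x * (a * y)"
      by (simp only: mult.assoc y)
    also have "\<dots> = a * (x * y)"
      by (simp only: mult.assoc[symmetric] x)
    finally show ?thesis
      by (simp add: centralizer_def)
  qed
qed

end

theory Submission
  imports Defs
begin

text \<open>
  Filtering a subalgebra \<open>B\<close> with \<open>D(l)\<close> by \<open>\<chi>\<close>, each step of the filtration has
  codimension at most \<open>l\<close>, so the elements of \<open>B\<close> of pseudo-degree less than \<open>m\<close> form a space
  of dimension at most \<open>l m\<close>. The \<open>(N + 1)\<^sup>2\<close> monomials \<open>a\<^sup>i b\<^sup>j\<close> with
  \<open>i, j \<le> N\<close> have pseudo-degree growing linearly in \<open>N\<close>, hence are linearly dependent for
  large \<open>N\<close>.
\<close>

section \<open>Linear algebra modulo a subspace\<close>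

text \<open>A maximal index set independent modulo \<open>V\<close> exists because \<open>I\<close>
  has finitely many subsets. Indices rather than vectors are selected, so that repeated values of
  \<open>f\<close> still count.\<close>

lemma (in vector_space) obtain_maximal_independent_mod:
  assumes "subspace V" and "finite I"
  obtains T where "T \<subseteq> I"
    and "\<And>c t. (\<Sum>i\<in>T. c i *s f i) \<in> V \<Longrightarrow> t \<in> T \<Longrightarrow> c t = 0"
    and "\<And>i. i \<in> I - T \<Longrightarrow> \<exists>c. f i + (\<Sum>t\<in>T. c t *s f t) \<in> V"
proof -
  define indep where "indep T \<longleftrightarrow> (\<forall>c. (\<Sum>i\<in>T. c i *s f i) \<in> V \<longrightarrow> (\<forall>t\<in>T. c t = 0))" for T
  have fin: "finite {T. T \<subseteq> I \<and> indep T}"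
    using \<open>finite I\<close> by (auto intro: finite_subset[of _ "Pow I"])
  have "{} \<in> {T. T \<subseteq> I \<and> indep T}"
    by (simp add: indep_def)
  with fin obtain T where T: "T \<subseteq> I" "indep T"
    and max: "\<And>T'. T' \<subseteq> I \<Longrightarrow> indep T' \<Longrightarrow> T \<subseteq> T' \<Longrightarrow> T = T'"
    using finite_has_maximal2[OF fin] by (metis (mono_tags, lifting) mem_Collect_eq)
  have "finite T"
    using T(1) \<open>finite I\<close> by (rule finite_subset)
  show thesis
  proof
    show "T \<subseteq> I" by fact
    show "c t = 0" if "(\<Sum>i\<in>T. c i *s f i) \<in> V" "t \<in> T" for c t
      using T(2) that by (auto simp: indep_def)
    show "\<exists>c. f i + (\<Sum>t\<in>T. c t *s f t) \<in> V" if i: "i \<in> I - T" for i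
    proof -
      have "\<not> indep (insert i T)"
        using max[of "insert i T"] i T(1) by blast
      then obtain c t where V: "(\<Sum>j\<in>insert i T. c j *s f j) \<in> V"
        and t: "t \<in> insert i T" "c t \<noteq> 0"
        by (auto simp: indep_def)
      have V': "c i *s f i + (\<Sum>j\<in>T. c j *s f j) \<in> V"
        using V i \<open>finite T\<close> by simp
      \<comment> \<open>With \<open>c i = 0\<close> the relation would involve only
        \<open>T\<close>, where independence makes every coefficient vanish. Dividing by
        \<open>c i\<close> then normalizes the coefficient of \<open>f i\<close> to 1.\<close>
      have "c i \<noteq> 0"
      proof
        assume "c i = 0"
        with V' T(2) t show False
          by (auto simp: indep_def)
      qed
      have "inverse (c i) *s (c i *s f i + (\<Sum>j\<in>T. c j *s f j)) \<in> V"
        using \<open>subspace V\<close> V' by (rule subspace_scale)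
      also have "inverse (c i) *s (c i *s f i + (\<Sum>j\<in>T. c j *s f j))
          = f i + (\<Sum>j\<in>T. (inverse (c i) * c j) *s f j)"
        using \<open>c i \<noteq> 0\<close> by (simp add: scale_right_distrib scale_sum_right)
      finally show ?thesis
        by (rule exI[of _ "\<lambda>j. inverse (c i) * c j"])
    qed
  qed
qed

text \<open>Expanding a relation among the corrected vectors gives one among the \<open>f i\<close>.
  Coefficients off \<open>T\<close> stay as they are, so the relation remains nontrivial.\<close>

lemma (in vector_space) dependent_extend:
  assumes "finite I" and "T \<subseteq> I"
    and "(\<Sum>i\<in>I - T. \<beta> i *s (f i + (\<Sum>t\<in>T. c i t *s f t))) = 0"
    and "\<exists>i\<in>I - T. \<beta> i \<noteq> 0"
  shows "\<exists>\<alpha>. (\<exists>i\<in>I. \<alpha> i \<noteq> 0) \<and> (\<Sum>i\<in>I. \<alpha> i *s f i) = 0"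
proof -
  \<comment> \<open>On \<open>T\<close> the coefficient collects what all the corrections contribute
    to \<open>f i\<close>.\<close>
  define \<alpha> where "\<alpha> i = (if i \<in> T then \<Sum>j\<in>I - T. \<beta> j * c j i else \<beta> i)" for i
  have "(\<Sum>i\<in>I. \<alpha> i *s f i) = (\<Sum>i\<in>I - T. \<alpha> i *s f i) + (\<Sum>t\<in>T. \<alpha> t *s f t)"
    using assms(1,2) by (simp add: sum.subset_diff)
  also have "(\<Sum>t\<in>T. \<alpha> t *s f t) = (\<Sum>t\<in>T. \<Sum>i\<in>I - T. \<beta> i *s (c i t *s f t))"
    by (intro sum.cong refl) (simp add: \<alpha>_def scale_sum_left)
  also have "\<dots> = (\<Sum>i\<in>I - T. \<beta> i *s (\<Sum>t\<in>T. c i t *s f t))"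
    by (subst sum.swap) (simp only: scale_sum_right)
  also have "(\<Sum>i\<in>I - T. \<alpha> i *s f i) = (\<Sum>i\<in>I - T. \<beta> i *s f i)"
    by (intro sum.cong) (auto simp: \<alpha>_def)
  finally have "(\<Sum>i\<in>I. \<alpha> i *s f i) = 0"
    using assms(3) by (simp add: scale_right_distrib sum.distrib)
  moreover have "\<exists>i\<in>I. \<alpha> i \<noteq> 0"
    using assms(4) by (auto simp: \<alpha>_def)
  ultimately show ?thesis
    by blast
qed

section \<open>Upper bounds for pseudo-degrees\<close>

lemma pseudo_degree_1:
  assumes "pseudo_degree \<chi>" and "(1 :: 's::{ring,monoid_mult}) \<noteq> 0"
  shows "\<chi> (1 :: 's) = Fin 0"
proof -
  have "\<chi> (1 :: 's) = \<chi> 1 + \<chi> 1" "\<chi> (1 :: 's) \<noteq> Minf" "\<chi> (1 :: 's) \<noteq> Pinf"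
    using assms unfolding pseudo_degree_def by (metis mult_1_left)+
  then show ?thesis
    by (cases "\<chi> (1 :: 's)") auto
qed

lemma pseudo_degree_mult_le:
  assumes "pseudo_degree \<chi>" and "\<chi> x \<le> Fin m" and "\<chi> y \<le> Fin n"
  shows "\<chi> (x * y) \<le> Fin (m + n)"
proof -
  have "\<chi> (x * y) = \<chi> x + \<chi> y"
    using assms(1) by (simp add: pseudo_degree_def)
  then show ?thesis
    using assms(2,3) by (cases "\<chi> x"; cases "\<chi> y") auto
qed

lemma pseudo_degree_power_le:
  fixes x :: "'s::{ring,monoid_mult}"
  assumes "pseudo_degree \<chi>" and "\<chi> x \<le> Fin m"
  shows "\<chi> (x ^ i) \<le> Fin (int i * m)"
proof (induction i)
  case 0
  show ?case
  \<comment> \<open>In the zero ring, which the sort admits, \<open>\<chi> 1\<close> is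
    \<open>Minf\<close> instead of 0.\<close>
  proof (cases "(1 :: 's) = 0")
    case True
    then have "\<chi> (1 :: 's) = Minf"
      using assms(1) by (simp add: pseudo_degree_def)
    then show ?thesis by simp
  next
    case False
    then show ?thesis
      using pseudo_degree_1[OF assms(1)] by simp
  qed
next
  case (Suc i)
  from pseudo_degree_mult_le[OF assms Suc] show ?case
    by (simp add: algebra_simps)
qed

text \<open>A nonnegative bound is wanted so that the resulting bounds on powers grow with the
  exponent.\<close>

lemma pseudo_degree_le_nat:
  assumes "pseudo_degree \<chi>"
  obtains m :: nat where "\<chi> x \<le> Fin (int m)"
proof (cases "\<chi> x")
  case (Fin n)
  then show thesis
    using that[of "nat n"] by simp
next
  case Pinf
  then show thesis
    using assms by (simp add: pseudo_degree_def)
next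
  case Minf
  then show thesis
    using that[of 0] by simp
qed

section \<open>The filtration by pseudo-degree and its dimensions\<close>

context K_algebra
begin

text \<open>The axioms for \<open>\<chi>\<close> do not mention scalars. For
  \<open>c \<noteq> 0\<close>, however, \<open>c *\<^sub>K 1\<close> and its inverse both lie in
  \<open>B\<close>, so their pseudo-degrees are nonnegative; they add up to
  \<open>\<chi> 1 = 0\<close>, hence both are 0.\<close>

lemma pseudo_degree_scale_le:
  assumes \<chi>: "pseudo_degree \<chi>" and B: "is_subalgebra scale B"
    and nonneg: "\<And>x. x \<in> B \<Longrightarrow> x \<noteq> 0 \<Longrightarrow> 0 \<le> \<chi> x"
  shows "\<chi> (c *\<^sub>K x) \<le> \<chi> x"
proof (cases "c *\<^sub>K x = 0")
  case True
  then have "\<chi> (c *\<^sub>K x) = Minf"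
    using \<chi> by (simp add: pseudo_degree_def)
  then show ?thesis by simp
next
  case False
  then have "c \<noteq> 0" and "x \<noteq> 0"
    by auto
  have one: "(1 :: 's) \<noteq> 0"
    using \<open>x \<noteq> 0\<close> by (metis mult_1_left mult_zero_left)
  have mult: "\<chi> (y * z) = \<chi> y + \<chi> z" for y z
    using \<chi> by (simp add: pseudo_degree_def)
  have ge: "0 \<le> \<chi> (d *\<^sub>K 1)" if "d \<noteq> 0" for d
    using that one B by (intro nonneg) (auto simp: is_subalgebra_def subspace_scale)
  have "(c *\<^sub>K 1) * (inverse c *\<^sub>K 1) = (1 :: 's)"
    using \<open>c \<noteq> 0\<close> by (simp flip: scale_mult_left scale_mult_right)
  then have "\<chi> (c *\<^sub>K 1) + \<chi> (inverse c *\<^sub>K 1) = Fin 0"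
    by (simp flip: mult add: pseudo_degree_1[OF \<chi> one])
  then have "\<chi> (c *\<^sub>K 1) = 0"
    using ge[of c] ge[of "inverse c"] \<open>c \<noteq> 0\<close>
    by (cases "\<chi> (c *\<^sub>K 1)"; cases "\<chi> (inverse c *\<^sub>K 1)") (auto simp: zero_extended_def)
  moreover have "c *\<^sub>K x = (c *\<^sub>K 1) * x"
    by (simp flip: scale_mult_left)
  ultimately show ?thesis
    by (simp add: mult)
qed

lemma subspace_pseudo_degree_less:
  assumes \<chi>: "pseudo_degree \<chi>" and B: "is_subalgebra scale B"
    and nonneg: "\<And>x. x \<in> B \<Longrightarrow> x \<noteq> 0 \<Longrightarrow> 0 \<le> \<chi> x"
  shows "subspace {x \<in> B. \<chi> x < Fin m}"
proof (rule subspaceI)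
  have sub: "subspace B"
    using B by (simp add: is_subalgebra_def)
  have "\<chi> 0 = Minf"
    using \<chi> by (simp add: pseudo_degree_def)
  then show "0 \<in> {x \<in> B. \<chi> x < Fin m}"
    using sub by (simp add: subspace_0)
  show "x + y \<in> {x \<in> B. \<chi> x < Fin m}"
    if "x \<in> {x \<in> B. \<chi> x < Fin m}" "y \<in> {x \<in> B. \<chi> x < Fin m}" for x y
  proof -
    have "\<chi> (x + y) \<le> max (\<chi> x) (\<chi> y)"
      using \<chi> by (simp add: pseudo_degree_def)
    also have "\<dots> < Fin m"
      using that by simp
    finally show ?thesis
      using that sub by (simp add: subspace_add)
  qed
  show "c *\<^sub>K x \<in> {x \<in> B. \<chi> x < Fin m}" if "x \<in> {x \<in> B. \<chi> x < Fin m}" for c x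
    using that sub pseudo_degree_scale_le[OF \<chi> B nonneg, of c x]
    by (auto simp: subspace_scale)
qed

text \<open>This bounds one graded piece of the filtration: the drop in pseudo-degree that
  \<open>D(l)\<close> provides is a nontrivial relation modulo the next lower step, so no
  \<open>l + 1\<close> vectors of pseudo-degree \<open>m\<close> are independent there.\<close>

lemma condition_D_card_le:
  assumes D: "condition_D scale \<chi> l B"
    and B: "\<And>t. t \<in> T \<Longrightarrow> f t \<in> B" and deg: "\<And>t. t \<in> T \<Longrightarrow> \<chi> (f t) = Fin m"
    and sub: "subspace B"
    and indep: "\<And>c t. \<lbrakk>(\<Sum>i\<in>T. c i *\<^sub>K f i) \<in> {x \<in> B. \<chi> x < Fin m}; t \<in> T\<rbrakk> \<Longrightarrow> c t = 0"
    and "finite T"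
  shows "card T \<le> l"
proof (rule ccontr)
  assume "\<not> card T \<le> l"
  then obtain T' where T': "T' \<subseteq> T" "card T' = l + 1"
    by (metis Suc_eq_plus1 not_less_eq_eq obtain_subset_with_card_n)
  have "finite T'"
    using T'(1) \<open>finite T\<close> by (rule finite_subset)
  then obtain h where h: "bij_betw h {1..l+1} T'"
    using T'(2) by (metis add_diff_cancel_left' bij_betw_iff_card card_atLeastAtMost
        diff_Suc_1 finite_atLeastAtMost Suc_eq_plus1)
  then have hT: "h i \<in> T" if "i \<in> {1..l+1}" for i
    using bij_betwE[OF h] that T'(1) by blast
  then have "\<forall>i\<in>{1..l+1}. f (h i) \<in> B \<and> \<chi> (f (h i)) = Fin m"
    using B deg by blast
  then obtain \<alpha> where \<alpha>: "\<exists>i\<in>{1..l+1}. \<alpha> i \<noteq> 0"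
    and drop: "\<chi> (\<Sum>i=1..l+1. \<alpha> i *\<^sub>K f (h i)) < \<chi> (f (h 1))"
    using conjunct2[OF D[unfolded condition_D_def], rule_format, of "\<lambda>i. f (h i)" m] by auto
  \<comment> \<open>The coefficients from \<open>D(l)\<close>, carried from \<open>{1..l+1}\<close>
    to \<open>T'\<close> along \<open>h\<close> and extended by 0 to \<open>T\<close>.\<close>
  define c where "c t = (if t \<in> T' then \<alpha> (inv_into {1..l+1} h t) else 0)" for t
  have inv: "inv_into {1..l+1} h (h i) = i" if "i \<in> {1..l+1}" for i
    using h that by (meson bij_betw_inv_into_left)
  have ch: "c (h i) = \<alpha> i" if "i \<in> {1..l+1}" for i
    using that h inv[OF that] by (auto simp: c_def dest: bij_betwE)
  have "(\<Sum>t\<in>T. c t *\<^sub>K f t) = (\<Sum>t\<in>T'. c t *\<^sub>K f t)"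
    using T'(1) \<open>finite T\<close> by (intro sum.mono_neutral_right) (auto simp: c_def)
  also have "\<dots> = (\<Sum>i=1..l+1. c (h i) *\<^sub>K f (h i))"
    using h by (simp add: sum.reindex_bij_betw[symmetric])
  also have "\<dots> = (\<Sum>i=1..l+1. \<alpha> i *\<^sub>K f (h i))"
    by (intro sum.cong refl) (simp only: ch)
  finally have eq: "(\<Sum>t\<in>T. c t *\<^sub>K f t) = (\<Sum>i=1..l+1. \<alpha> i *\<^sub>K f (h i))" .
  have "(\<Sum>t\<in>T. c t *\<^sub>K f t) \<in> B"
    using sub B by (intro subspace_sum subspace_scale)
  moreover have "\<chi> (\<Sum>t\<in>T. c t *\<^sub>K f t) < Fin m"
    using drop deg[OF hT[of 1]] by (simp only: eq) simp
  ultimately have "c (h i) = 0" if "i \<in> {1..l+1}" for i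
    using indep[of c "h i"] hT[OF that] by blast
  then show False
    using \<alpha> ch by fastforce
qed

text \<open>Induction on \<open>m\<close>: setting aside at most \<open>l\<close> vectors, the
  others can be corrected by these so as to fall into the next lower step.\<close>

lemma condition_D_dependent:
  assumes \<chi>: "pseudo_degree \<chi>" and B: "is_subalgebra scale B" and D: "condition_D scale \<chi> l B"
    and "finite I" and "\<And>i. i \<in> I \<Longrightarrow> f i \<in> B" and "\<And>i. i \<in> I \<Longrightarrow> \<chi> (f i) < Fin (int m)"
    and "card I > l * m"
  shows "\<exists>\<alpha>. (\<exists>i\<in>I. \<alpha> i \<noteq> 0) \<and> (\<Sum>i\<in>I. \<alpha> i *\<^sub>K f i) = 0"
  using assms(4-)
proof (induction m arbitrary: I f)
  case 0
  \<comment> \<open>Nonzero elements of \<open>B\<close> have pseudo-degree at least 0, so only zero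
    vectors remain and any coefficients give a relation.\<close>
  have "f i = 0" if "i \<in> I" for i
    using D 0(2,3)[OF that] by (force simp: condition_D_def zero_extended_def)
  moreover have "I \<noteq> {}"
    using 0 by auto
  ultimately show ?case
    by (intro exI[of _ "\<lambda>_. 1"]) auto
next
  case (Suc m)
  define V where "V = {x \<in> B. \<chi> x < Fin (int m)}"
  have nonneg: "0 \<le> \<chi> x" if "x \<in> B" "x \<noteq> 0" for x
    using D that by (simp add: condition_D_def)
  have sub: "subspace B"
    using B by (simp add: is_subalgebra_def)
  have V: "subspace V"
    unfolding V_def using subspace_pseudo_degree_less[OF \<chi> B nonneg] by blast
  obtain T where T: "T \<subseteq> I"
    and indep: "\<And>c t. (\<Sum>i\<in>T. c i *\<^sub>K f i) \<in> V \<Longrightarrow> t \<in> T \<Longrightarrow> c t = 0"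
    and span: "\<And>i. i \<in> I - T \<Longrightarrow> \<exists>c. f i + (\<Sum>t\<in>T. c t *\<^sub>K f t) \<in> V"
    using obtain_maximal_independent_mod[OF V \<open>finite I\<close>, of f] by blast
  have "finite T"
    using T \<open>finite I\<close> by (rule finite_subset)
  \<comment> \<open>If \<open>f t\<close> were in \<open>V\<close>, the coefficient family that is 1
    at \<open>t\<close> and 0 elsewhere would contradict independence.\<close>
  have "\<chi> (f t) = Fin (int m)" if t: "t \<in> T" for t
  proof -
    have "(\<Sum>i\<in>T. (if i = t then 1 else 0) *\<^sub>K f i) = (\<Sum>i\<in>T. if i = t then f i else 0)"
      by (intro sum.cong) auto
    also have "\<dots> = f t"
      using t \<open>finite T\<close> by simp
    finally have "f t \<notin> V"
      using indep[of "\<lambda>i. if i = t then 1 else 0" t] t by auto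
    moreover have "f t \<in> B" "\<chi> (f t) < Fin (int (Suc m))"
      using Suc.prems T t by auto
    ultimately show ?thesis
      by (cases "\<chi> (f t)") (auto simp: V_def)
  qed
  then have "card T \<le> l"
    using condition_D_card_le[OF D _ _ sub _ \<open>finite T\<close>, of f "int m"] Suc.prems(2) T indep
    unfolding V_def by blast
  then have card: "card (I - T) > l * m"
    using Suc.prems(4) T \<open>finite T\<close> by (simp add: card_Diff_subset)
  obtain c where c: "f i + (\<Sum>t\<in>T. c i t *\<^sub>K f t) \<in> V" if "i \<in> I - T" for i
    using span by metis
  \<comment> \<open>The induction hypothesis is applied to the corrected vectors, not to
    \<open>f\<close> itself.\<close>
  have "\<exists>\<beta>. (\<exists>i\<in>I - T. \<beta> i \<noteq> 0) \<and>
      (\<Sum>i\<in>I - T. \<beta> i *\<^sub>K (f i + (\<Sum>t\<in>T. c i t *\<^sub>K f t))) = 0"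
    using Suc.prems(1) c card by (intro Suc.IH) (auto simp: V_def)
  then show ?case
    using dependent_extend[OF \<open>finite I\<close> T] by blast
qed

section \<open>Polynomial relations from dependent monomials\<close>

lemma power_in_subalgebra:
  assumes "is_subalgebra scale B" and "x \<in> B"
  shows "x ^ n \<in> B"
  using assms by (induction n) (auto simp: is_subalgebra_def)

text \<open>Padding with zero coefficients replaces the degree-dependent ranges by a fixed square of
  exponents.\<close>

lemma eval2_bounded:
  assumes "degree P \<le> N" and "\<And>j. degree (coeff P j) \<le> N"
  shows "eval2 scale P a b = (\<Sum>j\<le>N. \<Sum>i\<le>N. coeff (coeff P j) i *\<^sub>K (a ^ i * b ^ j))"
proof -
  have "(\<Sum>i\<le>degree (coeff P j). coeff (coeff P j) i *\<^sub>K (a ^ i * b ^ j))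
      = (\<Sum>i\<le>N. coeff (coeff P j) i *\<^sub>K (a ^ i * b ^ j))" for j
    using assms(2) by (intro sum.mono_neutral_left) (auto simp: coeff_eq_0)
  then have "eval2 scale P a b
      = (\<Sum>j\<le>degree P. \<Sum>i\<le>N. coeff (coeff P j) i *\<^sub>K (a ^ i * b ^ j))"
    by (simp add: eval2_def)
  also have "\<dots> = (\<Sum>j\<le>N. \<Sum>i\<le>N. coeff (coeff P j) i *\<^sub>K (a ^ i * b ^ j))"
    using assms(1) by (intro sum.mono_neutral_left) (auto simp: coeff_eq_0)
  finally show ?thesis .
qed

lemma monomials_dependent_imp_eval2:
  assumes "(\<Sum>(i, j)\<in>{..N} \<times> {..N}. \<alpha> (i, j) *\<^sub>K (a ^ i * b ^ j)) = 0"
    and "\<exists>p\<in>{..N} \<times> {..N}. \<alpha> p \<noteq> 0"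
  shows "\<exists>P. P \<noteq> 0 \<and> eval2 scale P a b = 0"
proof -
  define Q where "Q j = (\<Sum>i\<le>N. monom (\<alpha> (i, j)) i)" for j
  define P where "P = (\<Sum>j\<le>N. monom (Q j) j)"
  have coeff_Q: "coeff (Q j) i = (if i \<le> N then \<alpha> (i, j) else 0)" for i j
    by (simp add: Q_def coeff_sum)
  have coeff_P: "coeff P j = (if j \<le> N then Q j else 0)" for j
    by (simp add: P_def coeff_sum)
  have "degree P \<le> N"
    by (rule degree_le) (simp add: coeff_P)
  moreover have "degree (coeff P j) \<le> N" for j
    by (rule degree_le) (simp add: coeff_P coeff_Q)
  ultimately have "eval2 scale P a b
      = (\<Sum>j\<le>N. \<Sum>i\<le>N. coeff (coeff P j) i *\<^sub>K (a ^ i * b ^ j))"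
    by (rule eval2_bounded)
  also have "\<dots> = (\<Sum>j\<le>N. \<Sum>i\<le>N. \<alpha> (i, j) *\<^sub>K (a ^ i * b ^ j))"
    by (simp add: coeff_P coeff_Q)
  also have "\<dots> = (\<Sum>(i, j)\<in>{..N} \<times> {..N}. \<alpha> (i, j) *\<^sub>K (a ^ i * b ^ j))"
    \<comment> \<open>The swap is needed because \<open>eval2\<close> has the exponent of
      \<open>t\<close> outermost, whereas pairs list the exponent of \<open>s\<close> first.\<close>
    by (subst sum.swap) (rule sum.cartesian_product)
  finally have "eval2 scale P a b = 0"
    using assms(1) by simp
  moreover obtain i j where "i \<le> N" "j \<le> N" "\<alpha> (i, j) \<noteq> 0"
    using assms(2) by auto
  then have "coeff (coeff P j) i \<noteq> 0"
    by (simp add: coeff_P coeff_Q)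
  then have "P \<noteq> 0"
    by auto
  ultimately show ?thesis
    by blast
qed

section \<open>Counting monomials\<close>

lemma condition_D_algebraically_dependent:
  assumes \<chi>: "pseudo_degree \<chi>" and B: "is_subalgebra scale B" and D: "condition_D scale \<chi> l B"
    and "a \<in> B" and "b \<in> B"
  shows "\<exists>P. P \<noteq> 0 \<and> eval2 scale P a b = 0"
proof -
  obtain m n :: nat where m: "\<chi> a \<le> Fin (int m)" and n: "\<chi> b \<le> Fin (int n)"
    using pseudo_degree_le_nat[OF \<chi>] by metis
  \<comment> \<open>The step containing the monomials has dimension at most
    \<open>l * (N * (m + n) + 1)\<close>, which is at most
    \<open>(N + 1) * (l * (m + n + 1)) = (N + 1) * N\<close>, hence less than the number
    \<open>(N + 1) * (N + 1)\<close> of monomials.\<close>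
  define N where "N = l * (m + n + 1)"
  have "\<exists>\<alpha>. (\<exists>p\<in>{..N} \<times> {..N}. \<alpha> p \<noteq> 0) \<and>
      (\<Sum>p\<in>{..N} \<times> {..N}. \<alpha> p *\<^sub>K (case p of (i, j) \<Rightarrow> a ^ i * b ^ j)) = 0"
  proof (rule condition_D_dependent[OF \<chi> B D])
    show "(case p of (i, j) \<Rightarrow> a ^ i * b ^ j) \<in> B" for p
      using power_in_subalgebra[OF B] assms(4,5) B by (auto simp: is_subalgebra_def split: prod.split)
    \<comment> \<open>The summand 1 turns the bound \<open>N * (m + n)\<close> into a strict one, as
      the filtration requires.\<close>
    show "\<chi> (case p of (i, j) \<Rightarrow> a ^ i * b ^ j) < Fin (int (N * (m + n) + 1))"
      if "p \<in> {..N} \<times> {..N}" for p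
    proof -
      obtain i j where p: "p = (i, j)" "i \<le> N" "j \<le> N"
        using \<open>p \<in> {..N} \<times> {..N}\<close> by auto
      have "\<chi> (a ^ i * b ^ j) \<le> Fin (int i * int m + int j * int n)"
        using pseudo_degree_mult_le[OF \<chi>] pseudo_degree_power_le[OF \<chi> m]
          pseudo_degree_power_le[OF \<chi> n] by blast
      also have "int i * int m + int j * int n = int (i * m + j * n)"
        by simp
      also have "i * m + j * n < N * (m + n) + 1"
        using mult_le_mono1[OF p(2), of m] mult_le_mono1[OF p(3), of n]
        unfolding distrib_left by linarith
      then have "Fin (int (i * m + j * n)) < Fin (int (N * (m + n) + 1))"
        by (simp only: less_extended_simps of_nat_less_iff)
      finally show ?thesis
        by (simp add: p(1))
    qed
    have "l * (N * (m + n) + 1) < (N + 1) * (l * (m + n + 1) + 1)"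
      by (simp add: algebra_simps)
    then show "l * (N * (m + n) + 1) < card ({..N} \<times> {..N})"
      by (simp add: N_def)
  qed simp
  then show ?thesis
    using monomials_dependent_imp_eval2[of _ a b N] by (auto simp: case_prod_unfold)
qed

end

theorem corollary2p7:
  fixes scale :: "'k::field \<Rightarrow> 's::{ring,monoid_mult} \<Rightarrow> 's"
    and \<chi> :: "'s \<Rightarrow> int extended"
    and l :: nat
    and a b :: 's
  assumes "K_algebra scale"
    and "pseudo_degree \<chi>"
    and "l > 0"
    and "condition_D scale \<chi> l (centralizer a)"
    and "b \<in> centralizer a"
  shows "\<exists>P :: 'k poly poly. P \<noteq> 0 \<and> eval2 scale P a b = 0"
proof -
  have "a \<in> centralizer a"
    by (simp add: centralizer_def)
  then show ?thesis
    using K_algebra.condition_D_algebraically_dependent K_algebra.is_subalgebra_centralizer assms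
    by blast
qed

end
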